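(* For every positive integer $n$ and every triple $(\epsilon,\alpha,\beta)$ of positive real numbers with $0<\epsilon<1$, there exists a positive number $m_\epsilon$ (depending only on $n,\epsilon,\alpha,\beta$) such that for every integer $m\ge 2$ with $m\geq m_{\epsilon}$ one has $$\frac{L_m}{\rho_{\min}} \geq 1-\epsilon$$ for every polynomial $p(z)=a_nz^n+\cdots+a_1z+a_0$ with complex coefficients and $a_na_0\neq 0$ that has degree $n$ and satisfies $$\max\{|a_0|,\ldots,|a_n|\}=\alpha \quad\text{and}\quad \max\{1,\rho_{\min}^n\}\cdot\sum_{j=0}^{n-1}\rho_{\min}^j=\beta .$$ Here $\rho_{\min}=\rho_{\min}(p)$ and $L_m=L_m(p)$ are as defined in the context.
   Context: Let $p(z)=a_nz^n+\cdots+a_1z+a_0$ be a complex polynomial of degree $n\ge 1$ with $a_na_0\neq 0$. - $\rho_{\min}:=\min\{|\rho| : p(\rho)=0\}$ is the smallest modulus of a zero of $p$. - For $j\ge 0$, $b_j$ is the coefficient of $z^j$ in the Maclaurin series of $1/p(z)$. - For each integer $m\ge 2$, $r_m$ is the unique positive root of $x^{m+1}+x-1$. - For each integer $m\ge 2$, $$\gamma_m:=\max_{k=m+1,\ldots,m+n}\left|\sum_{j=\max\{0,k-n\}}^{m}a_{k-j}b_j\right|^{1/k}.$$ - $L_m:=r_m/\gamma_m$ (Kalantari's lower bound on the moduli of the zeros of $p$). *)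

theory Defs
  imports "HOL-Complex_Analysis.Complex_Analysis" "HOL-Computational_Algebra.Fundamental_Theorem_Algebra"
begin

definition rho_min :: "complex poly \<Rightarrow> real" where
  "rho_min p = Min {cmod z |z. poly p z = 0}"

definition maclaurin_recip :: "complex poly \<Rightarrow> nat \<Rightarrow> complex" where
  "maclaurin_recip p j = fps_nth (fps_expansion (\<lambda>z. 1 / poly p z) 0) j"

definition kalantari_r :: "nat \<Rightarrow> real" where
  "kalantari_r m = (THE x. x > 0 \<and> x ^ (m + 1) + x - 1 = 0)"

text \<open>Subtraction on \<^typ>\<open>nat\<close> is truncated, so the lower summation limit below is the
  maximum of 0 and the integer difference of \<open>k\<close> and the degree of \<open>p\<close>; in the summand
  \<open>j \<le> m < k\<close>, so there no truncation takes place.\<close>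

definition kalantari_gamma :: "complex poly \<Rightarrow> nat \<Rightarrow> real" where
  "kalantari_gamma p m =
     Max ((\<lambda>k. root k (cmod (\<Sum>j = k - degree p..m. coeff p (k - j) * maclaurin_recip p j)))
          ` {m + 1..m + degree p})"

definition kalantari_L :: "complex poly \<Rightarrow> nat \<Rightarrow> real" where
  "kalantari_L p m = kalantari_r m / kalantari_gamma p m"

lemma kalantari_r_ex1: "\<exists>!x::real. x > 0 \<and> x ^ (m + 1) + x - 1 = 0"
proof (rule ex_ex1I)
  have "\<exists>x\<ge>0. x \<le> 1 \<and> x ^ (m + 1) + x - 1 = (0::real)"
    by (rule IVT') (auto intro!: continuous_intros)
  then obtain x :: real where x: "x \<ge> 0" "x ^ (m + 1) + x - 1 = 0" by blast
  then have "x \<noteq> 0" by auto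
  with x show "\<exists>x::real. x > 0 \<and> x ^ (m + 1) + x - 1 = 0"
    by (intro exI[of _ x]) auto
next
  fix x y :: real
  assume x: "x > 0 \<and> x ^ (m + 1) + x - 1 = 0" and y: "y > 0 \<and> y ^ (m + 1) + y - 1 = 0"
  have "\<not> u < v" if "u > 0" "u ^ (m + 1) + u - 1 = 0" "v ^ (m + 1) + v - 1 = 0" for u v :: real
    using that power_strict_mono[of u v "m + 1"] by linarith
  with x y show "x = y" by (meson linorder_neqE_linordered_idom)
qed

lemma zero_moduli_finite_nonempty:
  assumes "degree p \<ge> 1"
  shows "finite {cmod z |z. poly p z = 0}" "{cmod z |z. poly p z = 0} \<noteq> {}"
proof -
  have "p \<noteq> 0" using assms by auto
  then show "finite {cmod z |z. poly p z = 0}"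
    by (simp add: poly_roots_finite setcompr_eq_image)
  have "\<not> constant (poly p)" using assms by (simp add: constant_degree)
  then show "{cmod z |z. poly p z = 0} \<noteq> {}"
    using fundamental_theorem_of_algebra by blast
qed

end

theory Submission
  imports Defs
begin

text \<open>Write \<open>\<rho>\<close> for the smallest modulus of a zero of \<open>p\<close>. Dividing \<open>p\<close> by its constant term
  turns it into a product of \<open>n\<close> factors \<open>1 - z/w\<close>, one for each zero \<open>w\<close>, and \<open>\<bar>1/w\<bar> \<le> 1/\<rho>\<close>.
  Adding one factor at a time, we get
  \<open>\<bar>a\<^sub>k\<bar> \<le> 2\<^sup>n \<bar>a\<^sub>0\<bar> / \<rho>\<^sup>k\<close> for the coefficients of \<open>p\<close>, and
  \<open>\<bar>b\<^sub>j\<bar> \<le> (j+1)\<^sup>n / (\<bar>a\<^sub>0\<bar> \<rho>\<^sup>j)\<close> for those of \<open>1/p\<close> (lemma \<open>poly_and_recip_coeff_bounds\<close>).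
  In a product \<open>a\<^sub>k\<^sub>-\<^sub>j b\<^sub>j\<close> the constant term cancels and the power of \<open>\<rho>\<close> depends on \<open>k\<close>
  alone, so the \<open>k\<close>-th sum in the definition of \<open>\<gamma>\<^sub>m\<close> is at most
  \<open>2\<^sup>n (m+1)\<^sup>n\<^sup>+\<^sup>1 / \<rho>\<^sup>k\<close>. Because \<open>k \<ge> m+1\<close>, its \<open>k\<close>-th root is at most
  the \<open>(m+1)\<close>-st root of \<open>2\<^sup>n (m+1)\<^sup>n\<^sup>+\<^sup>1\<close>, divided by \<open>\<rho>\<close>. That root and \<open>r\<^sub>m\<close> both tend
  to 1 as \<open>m\<close> grows, and neither involves \<open>p\<close> except through \<open>n\<close>, which makes the lower bound on
  \<open>L\<^sub>m / \<rho>\<close> uniform.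

  One has to know in addition that \<open>\<gamma>\<^sub>m\<close> does not vanish (lemma \<open>kalantari_gamma_pos\<close>). It could
  vanish only if the Taylor polynomial of degree \<open>m\<close> of \<open>1/p\<close> were an exact inverse of \<open>p\<close>.\<close>

section \<open>Coefficients of a polynomial and of its reciprocal\<close>

lemma norm_coeff_mult_linear_factor_le:
  fixes c :: complex and S C :: real
  assumes c: "cmod c \<le> S" and q: "\<And>k. cmod (coeff q k) \<le> C * S ^ k"
  shows "cmod (coeff ([:1, - c:] * q) k) \<le> 2 * C * S ^ k"
proof (cases k)
  case 0
  have "0 \<le> C" using order_trans[OF norm_ge_zero q[of 0]] by simp
  then show ?thesis using q[of 0] 0 by simp
next
  case (Suc i)
  have "cmod (coeff ([:1, - c:] * q) k) = cmod (coeff q k - c * coeff q i)"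
    by (simp add: Suc)
  also have "\<dots> \<le> cmod (coeff q k) + cmod c * cmod (coeff q i)"
    by (metis norm_mult norm_triangle_ineq4)
  also have "\<dots> \<le> C * S ^ k + S * (C * S ^ i)"
    using c q[of i] by (intro add_mono q mult_mono order_trans[OF norm_ge_zero c]) auto
  finally show ?thesis by (simp add: Suc)
qed

lemma inverse_one_minus_const_fps_X:
  "inverse (1 - fps_const c * fps_X) = Abs_fps (\<lambda>n. (c :: complex) ^ n)"
  using one_minus_const_fps_X_neg_power'[of 1 c] by simp

text \<open>Multiplying by the geometric series raises the degree of the polynomial factor by one
  only, because a coefficient of the product is a sum of \<open>j + 1\<close> terms of the same size.\<close>

lemma norm_fps_nth_mult_geometric_le:
  fixes c :: complex and S C :: real
  assumes c: "cmod c \<le> S" and F: "\<And>j. cmod (fps_nth F j) \<le> C * (real j + 1) ^ d * S ^ j"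
  shows "cmod (fps_nth (F * inverse (1 - fps_const c * fps_X)) j)
           \<le> C * (real j + 1) ^ Suc d * S ^ j"
proof -
  have C: "0 \<le> C" using order_trans[OF norm_ge_zero F[of 0]] by simp
  have S: "0 \<le> S" using c norm_ge_zero[of c] by linarith
  have "cmod (fps_nth (F * inverse (1 - fps_const c * fps_X)) j)
          \<le> (\<Sum>i=0..j. cmod (fps_nth F i * c ^ (j - i)))"
    unfolding inverse_one_minus_const_fps_X by (simp add: fps_mult_nth norm_sum)
  also have "\<dots> \<le> (\<Sum>i=0..j. C * (real j + 1) ^ d * S ^ j)"
  proof (rule sum_mono)
    fix i assume i: "i \<in> {0..j}"
    have "cmod (fps_nth F i * c ^ (j - i)) \<le> (C * (real i + 1) ^ d * S ^ i) * S ^ (j - i)"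
      unfolding norm_mult norm_power using C S c
      by (intro mult_mono F power_mono) auto
    also have "\<dots> = C * (real i + 1) ^ d * S ^ j"
      using i by (simp flip: power_add add: mult.assoc)
    also have "\<dots> \<le> C * (real j + 1) ^ d * S ^ j"
      using i C S by (intro mult_right_mono mult_left_mono power_mono) auto
    finally show "cmod (fps_nth F i * c ^ (j - i)) \<le> C * (real j + 1) ^ d * S ^ j" .
  qed
  also have "\<dots> = C * (real j + 1) ^ Suc d * S ^ j"
    by simp
  finally show ?thesis .
qed

text \<open>Both bounds come out of one induction that splits off a factor \<open>1 - z/w\<close>. Normalising
  the factor to have constant term 1 keeps the constant term of \<open>p\<close> unchanged throughout.\<close>

lemma poly_and_recip_coeff_bounds:
  fixes p :: "complex poly"
  assumes "R > 0" and "degree p = n" and "p \<noteq> 0" and "\<And>z. poly p z = 0 \<Longrightarrow> R \<le> cmod z"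
  shows "(\<forall>k. cmod (coeff p k) \<le> 2 ^ n * cmod (coeff p 0) * (1 / R) ^ k) \<and>
    (\<forall>j. cmod (fps_nth (inverse (fps_of_poly p)) j)
           \<le> 1 / cmod (coeff p 0) * (real j + 1) ^ n * (1 / R) ^ j)"
  using assms(2-)
proof (induction n arbitrary: p)
  case 0
  then obtain a where p: "p = [:a:]" and a: "a \<noteq> 0"
    by (metis degree_eq_zeroE pCons_0_0)
  have "cmod (coeff p k) \<le> 2 ^ 0 * cmod (coeff p 0) * (1 / R) ^ k" for k
    using assms(1) by (cases k) (auto simp: p)
  moreover have "cmod (fps_nth (inverse (fps_of_poly p)) j)
           \<le> 1 / cmod (coeff p 0) * (real j + 1) ^ 0 * (1 / R) ^ j" for j
    using assms(1) a
    by (cases j) (auto simp: p fps_of_poly_const fps_const_inverse norm_divide norm_inverse field_simps)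
  ultimately show ?case by blast
next
  case (Suc n)
  have "\<not> constant (poly p)" using Suc.prems by (simp add: constant_degree)
  then obtain w where w: "poly p w = 0" using fundamental_theorem_of_algebra by blast
  then obtain q' where q': "p = [:- w, 1:] * q'" by (auto simp: poly_eq_0_iff_dvd dvd_def)
  have w0: "w \<noteq> 0" and Rw: "R \<le> cmod w" using Suc.prems(3)[OF w] assms(1) by auto
  define c where "c = 1 / w"
  define q where "q = smult (- w) q'"
  have pq: "p = [:1, - c:] * q"
  proof -
    have "[:1, - c:] * q = smult (- w) [:1, - c:] * q'"
      by (simp only: q_def mult_smult_left mult_smult_right)
    also have "smult (- w) [:1, - c:] = [:- w, 1:]" using w0 by (simp add: c_def)
    finally show ?thesis by (simp add: q')
  qed
  have c: "cmod c \<le> 1 / R"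
    using Rw assms(1) by (auto simp: c_def norm_divide intro!: divide_left_mono mult_pos_pos)
  have q0: "q \<noteq> 0" using Suc.prems(2) pq by auto
  have c0: "c \<noteq> 0" using w0 by (simp add: c_def)
  have "degree p = 1 + degree q"
    unfolding pq using q0 c0 by (subst degree_mult_eq) auto
  then have "degree q = n" using Suc.prems(1) by simp
  moreover have "R \<le> cmod z" if "poly q z = 0" for z
    using Suc.prems(3) that by (simp add: pq)
  ultimately have
    IH1: "\<And>k. cmod (coeff q k) \<le> 2 ^ n * cmod (coeff q 0) * (1 / R) ^ k" and
    IH2: "\<And>j. cmod (fps_nth (inverse (fps_of_poly q)) j)
           \<le> 1 / cmod (coeff q 0) * (real j + 1) ^ n * (1 / R) ^ j"
    using Suc.IH[of q] q0 by blast+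
  have pq0: "coeff p 0 = coeff q 0" by (simp add: pq)
  have inv: "inverse (fps_of_poly p)
               = inverse (fps_of_poly q) * inverse (1 - fps_const c * fps_X)"
    by (simp only: pq fps_of_poly_mult fps_inverse_mult fps_of_poly_linear' mult.commute)
       (simp flip: fps_const_neg)
  show ?case
    using norm_coeff_mult_linear_factor_le[OF c IH1] norm_fps_nth_mult_geometric_le[OF c IH2]
    unfolding inv pq0 by (simp add: pq mult.assoc)
qed

lemma maclaurin_recip_eq_fps_inverse:
  assumes "coeff p 0 \<noteq> 0"
  shows "maclaurin_recip p j = fps_nth (inverse (fps_of_poly p)) j"
proof -
  have "poly p has_fps_expansion fps_of_poly p"
    by (simp add: has_fps_expansion_def)
  then have "(\<lambda>z. inverse (poly p z)) has_fps_expansion inverse (fps_of_poly p)"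
    using assms by (intro has_fps_expansion_inverse) auto
  then have "fps_expansion (\<lambda>z. 1 / poly p z) 0 = inverse (fps_of_poly p)"
    by (intro fps_expansion_eqI) (simp add: divide_inverse)
  then show ?thesis by (simp add: maclaurin_recip_def)
qed

section \<open>Bounds for Kalantari's quantity gamma\<close>

lemma kalantari_gamma_le:
  fixes p :: "complex poly"
  assumes n: "degree p = n" "n \<ge> 1" and p0: "coeff p 0 \<noteq> 0"
    and R: "R > 0" "\<And>z. poly p z = 0 \<Longrightarrow> R \<le> cmod z"
  shows "kalantari_gamma p m \<le> root (m + 1) (2 ^ n * (real m + 1) ^ (n + 1)) / R"
proof -
  define B where "B = 2 ^ n * (real m + 1) ^ (n + 1)"
  have B: "B \<ge> 1"
    unfolding B_def using mult_mono[of 1 "2 ^ n" 1 "(real m + 1) ^ (n + 1)"]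
    by (simp add: one_le_power del: power_Suc)
  have "p \<noteq> 0" using p0 by auto
  then have
    a: "\<And>k. cmod (coeff p k) \<le> 2 ^ n * cmod (coeff p 0) * (1 / R) ^ k" and
    b: "\<And>j. cmod (maclaurin_recip p j) \<le> 1 / cmod (coeff p 0) * (real j + 1) ^ n * (1 / R) ^ j"
    using poly_and_recip_coeff_bounds[OF R(1) n(1)] R(2)
    by (auto simp: maclaurin_recip_eq_fps_inverse[OF p0])
  have "root k (cmod (\<Sum>j = k - n..m. coeff p (k - j) * maclaurin_recip p j))
          \<le> root (m + 1) B / R" if k: "k \<in> {m + 1..m + n}" for k
  proof -
    have term_le: "cmod (coeff p (k - j) * maclaurin_recip p j)
            \<le> 2 ^ n * (real m + 1) ^ n * (1 / R) ^ k" if "j \<le> m" for j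
    proof -
      have "cmod (coeff p (k - j) * maclaurin_recip p j)
          \<le> (2 ^ n * cmod (coeff p 0) * (1 / R) ^ (k - j))
            * (1 / cmod (coeff p 0) * (real j + 1) ^ n * (1 / R) ^ j)"
        unfolding norm_mult using R(1) by (intro mult_mono a b) auto
      also have "\<dots> = 2 ^ n * (real j + 1) ^ n * ((1 / R) ^ (k - j) * (1 / R) ^ j)"
        using p0 by simp
      also have "(1 / R) ^ (k - j) * (1 / R) ^ j = (1 / R) ^ k"
        using that k by (simp flip: power_add)
      also have "2 ^ n * (real j + 1) ^ n * (1 / R) ^ k
          \<le> 2 ^ n * (real m + 1) ^ n * (1 / R) ^ k"
        using that R(1) by (intro mult_right_mono mult_left_mono power_mono) auto
      finally show ?thesis .
    qed
    have "cmod (\<Sum>j = k - n..m. coeff p (k - j) * maclaurin_recip p j)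
        \<le> (\<Sum>j = k - n..m. 2 ^ n * (real m + 1) ^ n * (1 / R) ^ k)"
      by (intro sum_norm_le term_le) auto
    also have "\<dots> \<le> (\<Sum>j = 0..m. 2 ^ n * (real m + 1) ^ n * (1 / R) ^ k)"
      using R(1) by (intro sum_mono2) auto
    also have "\<dots> = B * (1 / R) ^ k" by (simp add: B_def)
    finally have "root k (cmod (\<Sum>j = k - n..m. coeff p (k - j) * maclaurin_recip p j))
        \<le> root k (B * (1 / R) ^ k)" using k by simp
    also have "\<dots> = root k B * (1 / R)"
      using k R(1) by (simp add: real_root_mult real_root_power_cancel del: power_one_over)
    also have "\<dots> \<le> root (m + 1) B * (1 / R)"
      using k B R(1) by (intro mult_right_mono real_root_decreasing) auto
    finally show ?thesis by simp
  qed
  then show ?thesis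
    unfolding kalantari_gamma_def B_def using n by (subst Max_le_iff) auto
qed

text \<open>The sums in the definition of \<open>\<gamma>\<^sub>m\<close> are the coefficients with index from \<open>m + 1\<close> to
  \<open>m + n\<close> of the product of \<open>p\<close> with the Taylor polynomial of degree \<open>m\<close> of \<open>1/p\<close>. All other
  coefficients of the product agree with those of 1, so if these vanish too then \<open>p\<close> is a unit,
  hence constant.\<close>

lemma kalantari_gamma_pos:
  fixes p :: "complex poly"
  assumes n: "degree p = n" "n \<ge> 1" and p0: "coeff p 0 \<noteq> 0"
  shows "kalantari_gamma p m > 0"
proof (rule ccontr)
  assume contra: "\<not> kalantari_gamma p m > 0"
  define b where "b = maclaurin_recip p"
  define Q where "Q = truncate_fps (m + 1) (inverse (fps_of_poly p))"
  have Q: "coeff Q j = (if j \<le> m then b j else 0)" for j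
    by (auto simp: Q_def b_def maclaurin_recip_eq_fps_inverse[OF p0] coeff_truncate_fps)
  have PQ: "coeff (Q * p) k = (\<Sum>j \<in> {..k} \<inter> {..m}. b j * coeff p (k - j))" for k
    unfolding coeff_mult Q by (rule sum.mono_neutral_cong_right) auto
  have "coeff (Q * p) k = coeff 1 k" for k
  proof -
    consider "k \<le> m" | "k \<in> {m + 1..m + n}" | "k > m + n" by force
    then show ?thesis
    proof cases
      case 1
      then have "coeff (Q * p) k = fps_nth (inverse (fps_of_poly p) * fps_of_poly p) k"
        unfolding PQ fps_mult_nth
        by (intro sum.cong) (auto simp: b_def maclaurin_recip_eq_fps_inverse[OF p0])
      also have "inverse (fps_of_poly p) * fps_of_poly p = 1"
        using p0 by (intro inverse_mult_eq_1) auto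
      finally show ?thesis by simp
    next
      case 2
      have "coeff (Q * p) k = (\<Sum>j = k - n..m. coeff p (k - j) * b j)"
        unfolding PQ using 2 n(1)
        by (intro sum.mono_neutral_cong_right) (auto simp: coeff_eq_0)
      moreover have "root k (cmod (\<Sum>j = k - n..m. coeff p (k - j) * b j))
                       \<le> kalantari_gamma p m"
        unfolding kalantari_gamma_def b_def n(1) using 2 by (intro Max_ge) auto
      ultimately have "root k (cmod (coeff (Q * p) k)) \<le> 0" using contra by simp
      then show ?thesis using 2 by auto
    next
      case 3
      have "coeff (Q * p) k = 0"
        unfolding PQ using 3 n(1) by (intro sum.neutral) (auto simp: coeff_eq_0)
      then show ?thesis using 3 by simp
    qed
  qed
  then have "Q * p = 1" by (intro poly_eqI)
  then have "p dvd 1" by (metis dvd_triv_right)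
  then show False using n p0 is_unit_iff_degree[of p] by fastforce
qed

section \<open>Limits as m grows\<close>

lemma kalantari_r_root:
  "kalantari_r m > 0" "kalantari_r m ^ (m + 1) + kalantari_r m - 1 = 0"
  using theI'[OF kalantari_r_ex1[of m]] by (auto simp: kalantari_r_def)

text \<open>The left-hand side of the defining equation of \<open>r\<^sub>m\<close> is increasing, and its value at a fixed
  \<open>y < 1\<close> tends to \<open>y - 1 < 0\<close>.\<close>

lemma kalantari_r_tendsto_1: "kalantari_r \<longlonglongrightarrow> 1"
proof (rule order_tendstoI)
  fix y :: real assume y: "y < 1"
  define x where "x = max 0 y"
  have x: "0 \<le> x" "x < 1" "y \<le> x" using y by (auto simp: x_def)
  have "(\<lambda>m. x ^ Suc m) \<longlonglongrightarrow> 0"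
    using x by (intro LIMSEQ_Suc LIMSEQ_power_zero) auto
  then have "eventually (\<lambda>m. x ^ Suc m < 1 - x) sequentially"
    using x by (intro order_tendstoD) auto
  then show "eventually (\<lambda>m. y < kalantari_r m) sequentially"
  proof eventually_elim
    case (elim m)
    show ?case
    proof (rule ccontr)
      assume "\<not> y < kalantari_r m"
      then have "kalantari_r m \<le> x" using x by simp
      then have "kalantari_r m ^ (m + 1) \<le> x ^ (m + 1)"
        using kalantari_r_root(1)[of m] by (intro power_mono) auto
      then show False using kalantari_r_root(2)[of m] elim \<open>kalantari_r m \<le> x\<close> by simp
    qed
  qed
next
  fix y :: real assume "1 < y"
  moreover have "kalantari_r m < 1" for m
    using kalantari_r_root[of m] zero_less_power[of "kalantari_r m" "m + 1"] by linarith
  ultimately show "eventually (\<lambda>m. kalantari_r m < y) sequentially"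
    by (intro always_eventually) (meson less_trans)
qed

lemma root_polynomial_tendsto_1:
  "(\<lambda>m. root (m + 1) (2 ^ n * (real m + 1) ^ d)) \<longlonglongrightarrow> 1"
proof -
  have "(\<lambda>k. root k (2 ^ n) * root k (real k) ^ d) \<longlonglongrightarrow> 1 * 1 ^ d"
    by (intro tendsto_mult tendsto_power LIMSEQ_root LIMSEQ_root_const) auto
  then have "(\<lambda>m. root (Suc m) (2 ^ n) * root (Suc m) (real (Suc m)) ^ d) \<longlonglongrightarrow> 1"
    by (subst (asm) filterlim_sequentially_Suc[symmetric]) simp
  then show ?thesis
    by (simp add: real_root_mult real_root_power add.commute)
qed

section \<open>The uniform lower bound\<close>

theorem theorem2:
  fixes n :: nat and \<epsilon> \<alpha> \<beta> :: real
  assumes "n \<ge> 1" and "0 < \<epsilon>" and "\<epsilon> < 1" and "0 < \<alpha>" and "0 < \<beta>"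
  shows "\<exists>m\<^sub>\<epsilon>::real. m\<^sub>\<epsilon> > 0 \<and>
    (\<forall>m::nat. m \<ge> 2 \<longrightarrow> real m \<ge> m\<^sub>\<epsilon> \<longrightarrow>
      (\<forall>p::complex poly.
         degree p = n \<longrightarrow>
         coeff p n * coeff p 0 \<noteq> 0 \<longrightarrow>
         Max ((\<lambda>i. cmod (coeff p i)) ` {0..n}) = \<alpha> \<longrightarrow>
         max 1 (rho_min p ^ n) * (\<Sum>j = 0..n - 1. rho_min p ^ j) = \<beta> \<longrightarrow>
         kalantari_L p m / rho_min p \<ge> 1 - \<epsilon>))"
proof -
  define t where "t = (\<lambda>m. root (m + 1) (2 ^ n * (real m + 1) ^ (n + 1)))"
  have "(\<lambda>m. kalantari_r m / t m) \<longlonglongrightarrow> 1 / 1"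
    unfolding t_def by (intro tendsto_divide kalantari_r_tendsto_1 root_polynomial_tendsto_1) auto
  then have "eventually (\<lambda>m. 1 - \<epsilon> < kalantari_r m / t m) sequentially"
    using assms(2) by (intro order_tendstoD) auto
  then obtain N where N: "\<And>m. m \<ge> N \<Longrightarrow> 1 - \<epsilon> < kalantari_r m / t m"
    by (auto simp: eventually_sequentially)
  have "kalantari_L p m / rho_min p \<ge> 1 - \<epsilon>"
    if m: "m \<ge> N" and p: "degree p = n" "coeff p 0 \<noteq> 0" for m and p :: "complex poly"
  proof -
    define \<rho> where "\<rho> = rho_min p"
    note moduli = zero_moduli_finite_nonempty[of p, unfolded p(1), OF assms(1)]
    have "\<rho> \<in> {cmod z |z. poly p z = 0}"
      unfolding \<rho>_def rho_min_def using moduli by (rule Min_in)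
    then have \<rho>: "\<rho> > 0" using p(2) by (auto simp: poly_0_coeff_0)
    have "\<rho> \<le> cmod z" if "poly p z = 0" for z
      unfolding \<rho>_def rho_min_def using moduli that by (intro Min_le) auto
    then have "kalantari_gamma p m \<le> t m / \<rho>"
      unfolding t_def using kalantari_gamma_le[OF p(1) assms(1) p(2) \<rho>] by blast
    then have le: "kalantari_gamma p m * \<rho> \<le> t m" using \<rho> by (simp add: field_simps)
    have pos: "kalantari_gamma p m * \<rho> > 0"
      using kalantari_gamma_pos[OF p(1) assms(1) p(2)] \<rho> by simp
    have "1 - \<epsilon> \<le> kalantari_r m / t m" using N[OF m] by simp
    also have "\<dots> \<le> kalantari_r m / (kalantari_gamma p m * \<rho>)"
      using le pos kalantari_r_root(1)[of m] by (intro divide_left_mono mult_pos_pos[OF _ pos]) auto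
    finally show ?thesis by (simp add: kalantari_L_def \<rho>_def)
  qed
  \<comment> \<open>adding 1 makes the threshold positive even when \<open>N = 0\<close>\<close>
  then show ?thesis by (intro exI[of _ "real N + 1"]) auto
qed

end
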